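(* Let $f:\mathbf{N}\to[0,\infty)$ be a function with $\sum_{n\ge1}f(n)=\infty$ such that the summable ideal $\mathcal{I}_f:=\{S\subseteq\mathbf{N}:\sum_{n\in S}f(n)<\infty\}$ is thinnable, and let $x=(x_n)_{n\in\mathbf{N}}$ be a sequence taking values in a separable metric space $X$. Then $$\lambda\left(\left\{\omega \in (0,1]: \Lambda_x(\mathcal{I}_f)=\Lambda_{x\upharpoonright \omega}(\mathcal{I}_f)\right\}\right)=1.$$
   Context: $\mathbf{N}$ denotes the positive integers. An ideal on $\mathbf{N}$ is a family $\mathcal{I}\subseteq\mathcal{P}(\mathbf{N})$ closed under finite unions and subsets, which contains all finite subsets of $\mathbf{N}$ and is different from $\mathcal{P}(\mathbf{N})$. For infinite sets $A,B\subseteq\mathbf{N}$ with increasing enumerations $\{a_n\}$ and $\{b_n\}$, write $A\le B$ if $a_n\le b_n$ for all $n$, and $A_B:=\{a_b:b\in B\}$. The asymptotic density of $A$ is $\lim_n|A\cap[1,n]|/n$, when it exists. An ideal $\mathcal{I}$ is thinnable if: $A_B\notin\mathcal{I}$ and $B_A\notin\mathcal{I}$ whenever $A\subseteq\mathbf{N}$ admits non-zero asymptotic density and $B\notin\mathcal{I}$; and $X\notin\mathcal{I}$ whenever $X\le Y$ and $Y\notin\mathcal{I}$. For an ideal $\mathcal{I}$, a point $\ell$ is an $\mathcal{I}$-limit point of a sequence $x$ if there is a subsequence $(x_{n_k})$ with $\lim_k x_{n_k}=\ell$ and $\{n_k:k\in\mathbf{N}\}\notin\mathcal{I}$; the set of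 these is $\Lambda_x(\mathcal{I})$. For $\omega\in(0,1]$ with non-terminating dyadic expansion $\omega=\sum_{i\ge1}d_i(\omega)2^{-i}$ (so $d_i(\omega)\in\{0,1\}$, with infinitely many equal to $1$), $x\upharpoonright\omega$ denotes the subsequence of $(x_n)$ obtained by omitting $x_i$ if and only if $d_i(\omega)=0$, re-indexed by $\mathbf{N}$. $\lambda$ is Lebesgue measure on the completion of the Borel $\sigma$-algebra of $(0,1]$ (so the claim includes measurability of the set). *)

theory Defs
  imports "HOL-Analysis.Analysis"
begin

text \<open>
  The positive integers are rendered as \<open>{1..} :: nat set\<close>. A family on them is a
  \<open>nat set set\<close> all of whose members avoid 0, and sequences are indexed from 1
  (the value at 0 is never used).
\<close>

subsection \<open>Ideals\<close>

definition ideal_on_pos :: "nat set set \<Rightarrow> bool" where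
  "ideal_on_pos \<I> \<longleftrightarrow>
     \<I> \<subseteq> Pow {1..} \<and>
     (\<forall>S\<in>\<I>. \<forall>T\<in>\<I>. S \<union> T \<in> \<I>) \<and>
     (\<forall>S\<in>\<I>. \<forall>T. T \<subseteq> S \<longrightarrow> T \<in> \<I>) \<and>
     (\<forall>S. S \<subseteq> {1..} \<and> finite S \<longrightarrow> S \<in> \<I>) \<and>
     \<I> \<noteq> Pow {1..}"

text \<open>
  For the nonnegative functions considered here, summability over \<open>S\<close> says exactly that the
  sum over \<open>S\<close> is finite.
\<close>

definition summable_ideal :: "(nat \<Rightarrow> real) \<Rightarrow> nat set set" where
  "summable_ideal f = {S. S \<subseteq> {1..} \<and> f summable_on S}"

text \<open>The increasing enumeration of an infinite set, starting at index 1.\<close>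

definition nth_elem :: "nat set \<Rightarrow> nat \<Rightarrow> nat" where
  "nth_elem A n = enumerate A (n - 1)"

definition set_le :: "nat set \<Rightarrow> nat set \<Rightarrow> bool" where
  "set_le A B \<longleftrightarrow> (\<forall>n\<ge>1. nth_elem A n \<le> nth_elem B n)"

definition thin_by :: "nat set \<Rightarrow> nat set \<Rightarrow> nat set" where
  "thin_by A B = nth_elem A ` B"

definition has_density :: "nat set \<Rightarrow> real \<Rightarrow> bool" where
  "has_density A \<delta> \<longleftrightarrow> (\<lambda>n. real (card (A \<inter> {1..n})) / real n) \<longlonglongrightarrow> \<delta>"

text \<open>
  Sets of non-zero density, and sets outside an ideal, are automatically infinite, so only \<open>X\<close>
  in the last clause needs an explicit infinity assumption for its enumeration to make sense.
\<close>

definition thinnable :: "nat set set \<Rightarrow> bool" where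
  "thinnable \<I> \<longleftrightarrow>
     ideal_on_pos \<I> \<and>
     (\<forall>A B. A \<subseteq> {1..} \<and> B \<subseteq> {1..} \<and> (\<exists>\<delta>. \<delta> \<noteq> 0 \<and> has_density A \<delta>) \<and> B \<notin> \<I> \<longrightarrow>
        thin_by A B \<notin> \<I> \<and> thin_by B A \<notin> \<I>) \<and>
     (\<forall>X Y. X \<subseteq> {1..} \<and> Y \<subseteq> {1..} \<and> infinite X \<and> set_le X Y \<and> Y \<notin> \<I> \<longrightarrow> X \<notin> \<I>)"

definition limit_points :: "(nat \<Rightarrow> 'a::topological_space) \<Rightarrow> nat set set \<Rightarrow> 'a set" where
  "limit_points x \<I> =
     {l. \<exists>n :: nat \<Rightarrow> nat. strict_mono n \<and> range n \<subseteq> {1..} \<and>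
           (\<lambda>k. x (n k)) \<longlonglongrightarrow> l \<and> range n \<notin> \<I>}"

subsection \<open>Dyadic expansions and subsequences\<close>

text \<open>
  The clause \<open>d 0 = 0\<close> only normalises the digit at the unused index 0, so that the expansion
  is unique as a function.
\<close>

definition dyadic_expansion :: "real \<Rightarrow> (nat \<Rightarrow> nat) \<Rightarrow> bool" where
  "dyadic_expansion \<omega> d \<longleftrightarrow>
     d 0 = 0 \<and> (\<forall>i. d i \<in> {0, 1}) \<and> infinite {i. d i = 1} \<and>
     (\<lambda>i. real (d i) / 2 ^ i) sums \<omega>"

definition dyadic_digit :: "real \<Rightarrow> nat \<Rightarrow> nat" where
  "dyadic_digit \<omega> = (THE d. dyadic_expansion \<omega> d)"

definition subseq_along :: "(nat \<Rightarrow> 'a) \<Rightarrow> real \<Rightarrow> nat \<Rightarrow> 'a" where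
  "subseq_along x \<omega> k = x (nth_elem {i. i \<ge> 1 \<and> dyadic_digit \<omega> i \<noteq> 0} k)"

subsection \<open>Existence and uniqueness of the non-terminating dyadic expansion\<close>

lemma dyadic_expansion_ceiling:
  assumes "dyadic_expansion \<omega> d"
  shows "\<lceil>2 ^ n * \<omega>\<rceil> - 1 = (\<Sum>i\<le>n. int (d i) * 2 ^ (n - i))"
proof -
  let ?g = "\<lambda>i. real (d i) / 2 ^ i"
  let ?t = "\<lambda>i. ?g (i + Suc n)"
  have d: "d i = 0 \<or> d i = 1" for i
    using assms by (auto simp: dyadic_expansion_def)
  have inf: "infinite {i. d i = 1}" and sums: "?g sums \<omega>"
    using assms by (auto simp: dyadic_expansion_def)
  have tail: "?t sums (\<omega> - (\<Sum>i<Suc n. ?g i))"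
    using sums_split_initial_segment [OF sums] by blast
  obtain m where m: "m > n" "d m = 1"
    using inf by (metis (mono_tags, lifting) infinite_nat_iff_unbounded mem_Collect_eq)
  have "0 < suminf ?t"
  proof (rule suminf_pos2)
    show "summable ?t" using tail by (rule sums_summable)
    show "0 < ?t (m - Suc n)" using m by simp
  qed simp
  then have lower: "(\<Sum>i<Suc n. ?g i) < \<omega>"
    using tail by (simp add: sums_iff)
  have geo: "(\<lambda>i. (1/2)^Suc n * (1/2) ^ i) sums ((1/2)^Suc n * (1 / (1 - 1/2 :: real)))"
    by (rule sums_mult, rule geometric_sums) simp
  have "\<omega> - (\<Sum>i<Suc n. ?g i) \<le> (1/2)^Suc n * (1 / (1 - 1/2))"
  proof (rule sums_le [OF _ tail geo])
    show "?t i \<le> (1/2)^Suc n * (1/2) ^ i" for i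
      using d[of "i + Suc n"] by (auto simp: power_add power_one_over field_simps)
  qed
  then have upper: "\<omega> \<le> (\<Sum>i<Suc n. ?g i) + (1/2)^n" by simp
  have scale: "2 ^ n * (\<Sum>i<Suc n. ?g i) = of_int (\<Sum>i\<le>n. int (d i) * 2 ^ (n - i))"
    unfolding sum_distrib_left lessThan_Suc_atMost of_int_sum
  proof (rule sum.cong)
    fix i assume "i \<in> {..n}"
    then have "(2::real) ^ n = 2 ^ (n - i) * 2 ^ i"
      by (simp flip: power_add)
    then show "2 ^ n * ?g i = of_int (int (d i) * 2 ^ (n - i))" by simp
  qed simp
  have "of_int (\<Sum>i\<le>n. int (d i) * 2 ^ (n - i)) < 2 ^ n * \<omega>"
    unfolding scale [symmetric] using lower by simp
  moreover have "2 ^ n * \<omega> \<le> 2 ^ n * ((\<Sum>i<Suc n. ?g i) + (1/2)^n)"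
    using upper by (intro mult_left_mono) auto
  then have "2 ^ n * \<omega> \<le> of_int (\<Sum>i\<le>n. int (d i) * 2 ^ (n - i)) + 1"
    unfolding scale [symmetric] distrib_left by (simp add: power_one_over)
  ultimately show ?thesis by linarith
qed

lemma dyadic_expansion_unique:
  assumes "dyadic_expansion \<omega> d" "dyadic_expansion \<omega> e"
  shows "d = e"
proof
  have step: "int (c (Suc n)) = (\<lceil>2 ^ Suc n * \<omega>\<rceil> - 1) - 2 * (\<lceil>2 ^ n * \<omega>\<rceil> - 1)"
    if "dyadic_expansion \<omega> c" for c n
    unfolding dyadic_expansion_ceiling [OF that] sum.atMost_Suc sum_distrib_left
    by (simp add: Suc_diff_le mult.left_commute)
  show "d n = e n" for n
  proof (cases n)
    case 0
    then show ?thesis using assms by (simp add: dyadic_expansion_def)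
  next
    case (Suc k)
    then show ?thesis using step[OF assms(1), of k] step[OF assms(2), of k] by simp
  qed
qed

lemma dyadic_expansion_exists:
  assumes "0 < \<omega>" "\<omega> \<le> 1"
  shows "\<exists>d. dyadic_expansion \<omega> d"
proof -
  define c where "c = (\<lambda>n. \<lceil>2 ^ n * \<omega>\<rceil> - 1)"
  define d where "d = (\<lambda>n. case n of 0 \<Rightarrow> 0 | Suc k \<Rightarrow> nat (c (Suc k) - 2 * c k))"
  have c0: "c 0 = 0"
    using assms unfolding c_def by simp linarith
  have c_bounds: "of_int (c n) < 2 ^ n * \<omega>" "2 ^ n * \<omega> \<le> of_int (c n) + 1" for n
    unfolding c_def by linarith+
  have c_step: "c (Suc k) - 2 * c k \<in> {0, 1}" for k
    using c_bounds[of k] c_bounds[of "Suc k"] by simp linarith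
  have d01: "d i \<in> {0, 1}" for i
  proof (cases i)
    case (Suc k)
    then show ?thesis using c_step[of k] by (auto simp: d_def)
  qed (simp add: d_def)
  have d_Suc: "int (d (Suc k)) = c (Suc k) - 2 * c k" for k
    using c_step[of k] by (auto simp: d_def)
  have partial: "(\<Sum>i\<le>n. real (d i) / 2 ^ i) = of_int (c n) / 2 ^ n" for n
  proof (induction n)
    case 0
    then show ?case by (simp add: c0 d_def)
  next
    case (Suc n)
    have "real (d (Suc n)) = of_int (c (Suc n)) - 2 * of_int (c n)"
      using arg_cong [OF d_Suc, of real_of_int n] by simp
    then show ?case using Suc by (simp add: field_simps)
  qed
  have less: "(\<Sum>i\<le>n. real (d i) / 2 ^ i) < \<omega>" for n
    using c_bounds(1)[of n] by (simp add: partial field_simps)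
  have close: "\<omega> - (1/2) ^ n \<le> (\<Sum>i\<le>n. real (d i) / 2 ^ i)" for n
  proof -
    have "\<omega> \<le> (of_int (c n) + 1) / 2 ^ n"
      using c_bounds(2)[of n] by (simp add: field_simps)
    then show ?thesis by (simp add: partial add_divide_distrib power_one_over)
  qed
  have "(\<lambda>n. (1/2::real) ^ n) \<longlonglongrightarrow> 0"
    by (rule LIMSEQ_power_zero) simp
  from tendsto_diff [OF tendsto_const this]
  have lim: "(\<lambda>n. \<omega> - (1/2) ^ n) \<longlonglongrightarrow> \<omega>" by simp
  have "(\<lambda>n. \<Sum>i\<le>n. real (d i) / 2 ^ i) \<longlonglongrightarrow> \<omega>"
    by (rule tendsto_sandwich [OF always_eventually always_eventually lim tendsto_const])
       (use close less in \<open>auto intro: less_imp_le\<close>)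
  then have sums: "(\<lambda>i. real (d i) / 2 ^ i) sums \<omega>"
    by (simp add: sums_def_le)
  have "infinite {i. d i = 1}"
  proof
    assume fin: "finite {i. d i = 1}"
    then obtain n where n: "{i. d i = 1} \<subseteq> {..n}"
      by (meson finite_nat_iff_bounded_le)
    have "(\<lambda>i. real (d i) / 2 ^ i) sums (\<Sum>i\<le>n. real (d i) / 2 ^ i)"
      using n d01 by (intro sums_finite) force+
    then show False
      using sums_unique2 [OF sums] less [of n] by auto
  qed
  moreover have "d 0 = 0" by (simp add: d_def)
  ultimately show ?thesis
    using d01 sums unfolding dyadic_expansion_def by blast
qed

lemma dyadic_expansion_dyadic_digit:
  assumes "0 < \<omega>" "\<omega> \<le> 1"
  shows "dyadic_expansion \<omega> (dyadic_digit \<omega>)"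
  unfolding dyadic_digit_def
proof -
  obtain d where d: "dyadic_expansion \<omega> d"
    using dyadic_expansion_exists [OF assms] by blast
  show "dyadic_expansion \<omega> (THE d. dyadic_expansion \<omega> d)"
    by (rule theI [where P = "dyadic_expansion \<omega>", OF d])
       (rule dyadic_expansion_unique [OF _ d])
qed

end

theory Submission
  imports Defs "HOL-Probability.Hoeffding"
begin

text \<open>
  For a summable ideal the limit points of a sequence are exactly its cluster points: \<open>l\<close> is one
  iff no ball around \<open>l\<close> has its index set in the ideal. By separability, only the countably many
  index sets \<open>Q\<close> of balls with centres in a countable dense set and radii \<open>1 / (m + 1)\<close> matter.
  The dyadic digits of \<open>\<omega>\<close> are independent fair bits, so almost surely the set \<open>A\<close> of retained
  indices has density \<open>1/2\<close> and \<open>A \<inter> Q\<close> lies outside the ideal whenever \<open>Q\<close> does. For such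
  \<open>\<omega>\<close>, thinnability transfers index sets outside the ideal between \<open>x\<close> and its subsequence: from
  the subsequence to \<open>x\<close> by the density clause, and back by the domination clause, since
  \<open>k \<le> a\<^sub>k\<close>.
\<close>

section \<open>Limit points with respect to summable ideals\<close>

lemma summable_on_nonneg_iff:
  fixes f :: "'a \<Rightarrow> real"
  assumes "\<And>n. n \<in> S \<Longrightarrow> f n \<ge> 0"
  shows "f summable_on S \<longleftrightarrow> (\<exists>C. \<forall>F. finite F \<and> F \<subseteq> S \<longrightarrow> sum f F \<le> C)"
proof
  assume "f summable_on S"
  then show "\<exists>C. \<forall>F. finite F \<and> F \<subseteq> S \<longrightarrow> sum f F \<le> C"
    using assms by (intro exI [of _ "infsum f S"]) (auto intro!: finite_sum_le_infsum)
next
  assume "\<exists>C. \<forall>F. finite F \<and> F \<subseteq> S \<longrightarrow> sum f F \<le> C"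
  then have "bdd_above (sum f ` {F. F \<subseteq> S \<and> finite F})"
    by (auto simp: bdd_above_def)
  then show "f summable_on S"
    using assms by (intro nonneg_bdd_above_summable_on) auto
qed

text \<open>Discarding the finitely many indices up to \<open>N\<close> leaves the sum divergent, so
  some finite set beyond \<open>N\<close> has mass above \<open>C\<close>; enlarging it to a full
  window only adds nonnegative terms.\<close>

lemma not_summable_on_sum_ge:
  fixes f :: "nat \<Rightarrow> real"
  assumes nonneg: "\<And>n. n \<in> S \<Longrightarrow> f n \<ge> 0" and S: "\<not> f summable_on S"
  obtains m where "m > N" "sum f (S \<inter> {N<..m}) \<ge> C"
proof -
  have "\<not> f summable_on (S \<inter> {N<..})"
  proof
    assume "f summable_on (S \<inter> {N<..})"
    moreover have "f summable_on (S \<inter> {..N})" by (rule summable_on_finite) auto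
    ultimately have "f summable_on ((S \<inter> {..N}) \<union> (S \<inter> {N<..}))"
      by (intro summable_on_Un_disjoint) auto
    moreover have "(S \<inter> {..N}) \<union> (S \<inter> {N<..}) = S" by auto
    ultimately show False using S by simp
  qed
  then have "\<not> (\<exists>C. \<forall>F. finite F \<and> F \<subseteq> S \<inter> {N<..} \<longrightarrow> sum f F \<le> C)"
    using summable_on_nonneg_iff [of "S \<inter> {N<..}" f] nonneg by simp
  then obtain F where "finite F" "F \<subseteq> S \<inter> {N<..}" "\<not> sum f F \<le> C"
    by blast
  then have F: "finite F" "F \<subseteq> S \<inter> {N<..}" "sum f F > C"
    by auto
  \<comment> \<open>\<open>F\<close> may be empty when \<open>C\<close> is negative; inserting
    \<open>Suc N\<close> keeps the maximum meaningful and forces \<open>m > N\<close>.\<close>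
  define m where "m = Max (insert (Suc N) F)"
  have m: "k \<le> m" if "k \<in> insert (Suc N) F" for k
    unfolding m_def using F(1) that by (intro Max_ge) auto
  have "m > N" using m [of "Suc N"] by simp
  have "F \<subseteq> S \<inter> {N<..m}" using F m by auto
  then have "sum f F \<le> sum f (S \<inter> {N<..m})"
    using nonneg by (intro sum_mono2) auto
  then show thesis using F \<open>m > N\<close> by (intro that [of m]) auto
qed

text \<open>
  Summable ideals are \<open>F\<^sub>\<sigma>\<close>, which is why limit points and cluster points coincide: a set
  outside the ideal is glued from finite blocks of mass at least 1 taken from smaller and
  smaller balls.
\<close>

lemma limit_points_summable_ideal:
  fixes f :: "nat \<Rightarrow> real" and y :: "nat \<Rightarrow> 'a::metric_space"
  assumes nonneg: "\<And>n. n \<ge> 1 \<Longrightarrow> f n \<ge> 0"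
  shows "limit_points y (summable_ideal f) =
    {l. \<forall>e>0. {n\<in>{1..}. dist (y n) l < e} \<notin> summable_ideal f}"
proof (intro set_eqI iffI)
  fix l assume "l \<in> limit_points y (summable_ideal f)"
  then obtain n where n: "strict_mono n" "range n \<subseteq> {1..}" "(\<lambda>k. y (n k)) \<longlonglongrightarrow> l"
      "range n \<notin> summable_ideal f"
    by (auto simp: limit_points_def)
  have "\<not> f summable_on {n\<in>{1..}. dist (y n) l < e}" if "e > 0" for e
  proof
    assume sum: "f summable_on {n\<in>{1..}. dist (y n) l < e}"
    obtain k0 where k0: "\<And>k. k \<ge> k0 \<Longrightarrow> dist (y (n k)) l < e"
      using n(3) \<open>e > 0\<close> by (metis lim_sequentially)
    have "f summable_on (n ` {k0..})"
      by (rule summable_on_subset_banach [OF sum]) (use n(2) k0 in auto)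
    moreover have "f summable_on (n ` {..<k0})" by (rule summable_on_finite) simp
    ultimately have "f summable_on (n ` {k0..} \<union> n ` {..<k0})"
      using n(1) by (intro summable_on_Un_disjoint) (auto simp: strict_mono_eq)
    moreover have "n ` {k0..} \<union> n ` {..<k0} = range n"
    proof -
      have "{k0..} \<union> {..<k0} = UNIV" by auto
      then show ?thesis by (metis image_Un)
    qed
    ultimately show False using n by (simp add: summable_ideal_def)
  qed
  then show "l \<in> {l. \<forall>e>0. {n\<in>{1..}. dist (y n) l < e} \<notin> summable_ideal f}"
    by (auto simp: summable_ideal_def)
next
  fix l assume l: "l \<in> {l. \<forall>e>0. {n\<in>{1..}. dist (y n) l < e} \<notin> summable_ideal f}"
  define U where "U j = {n\<in>{1..}. dist (y n) l < 1 / real (Suc j)}" for j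
  have U: "\<not> f summable_on U j" for j
  proof -
    have "U j \<notin> summable_ideal f"
      using l unfolding U_def by simp
    then show ?thesis by (auto simp: U_def summable_ideal_def)
  qed
  have "\<exists>m>N. sum f (U j \<inter> {N<..m}) \<ge> 1" for j N
    by (rule not_summable_on_sum_ge [OF _ U [of j], of N 1])
      (use nonneg in \<open>auto simp: U_def\<close>)
  \<comment> \<open>Dependent choice of cut points: block \<open>j\<close>, of mass at least 1 and
    taken from \<open>U j\<close>, lies strictly after all earlier blocks.\<close>
  then obtain N where N: "\<And>j. N (Suc j) > N j" "\<And>j. sum f (U j \<inter> {N j<..N (Suc j)}) \<ge> 1"
    using dependent_nat_choice [of "\<lambda>_ _. True" "\<lambda>j N m. m > N \<and> sum f (U j \<inter> {N<..m}) \<ge> 1"]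
    by auto
  have mono: "strict_mono N" using N(1) by (rule strict_monoI_Suc)
  define G where "G j = U j \<inter> {N j<..N (Suc j)}" for j
  define S where "S = (\<Union>j. G j)"
  have Spos: "S \<subseteq> {1..}" by (auto simp: S_def G_def U_def)
  have sums: "sum f (\<Union>j<m. G j) \<ge> m" for m
  proof (induction m)
    case (Suc m)
    have "N (Suc j) \<le> N m" if "j < m" for j
      using that mono by (simp add: strict_mono_less_eq)
    then have "G m \<inter> (\<Union>j<m. G j) = {}"
      by (fastforce simp: G_def)
    then have "sum f (\<Union>j<Suc m. G j) = sum f (G m) + sum f (\<Union>j<m. G j)"
      by (simp add: lessThan_Suc, subst sum.union_disjoint) (auto simp: G_def)
    then show ?case using Suc N(2) [of m] by (simp add: G_def)
  qed simp
  have not_sum: "\<not> f summable_on S"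
  proof
    assume sum: "f summable_on S"
    obtain m :: nat where "infsum f S < m" using reals_Archimedean2 by blast
    moreover have "sum f (\<Union>j<m. G j) \<le> infsum f S"
      using Spos nonneg by (intro finite_sum_le_infsum [OF sum]) (auto simp: S_def G_def)
    ultimately show False using sums [of m] by linarith
  qed
  then have inf: "infinite S" by auto
  have range: "range (enumerate S) = S"
    by (rule range_enumerate [OF inf])
  have "\<exists>k0. \<forall>k\<ge>k0. dist (y (enumerate S k)) l < e" if "e > 0" for e
  proof -
    obtain J where J: "1 / real (Suc J) < e"
      using nat_approx_posE [OF \<open>e > 0\<close>] by auto
    have "dist (y (enumerate S k)) l < e" if k: "k \<ge> Suc (N J)" for k
    proof -
      obtain j where j: "enumerate S k \<in> G j"
        using enumerate_in_set [OF inf, of k] by (auto simp: S_def)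
      \<comment> \<open>\<open>N J < k \<le> enumerate S k\<close>, while membership in block
        \<open>j\<close> gives \<open>enumerate S k \<le> N (Suc j)\<close>; so late elements of
        \<open>S\<close> only come from blocks with small radius.\<close>
      have "N J < N (Suc j)"
        using j k le_enumerate [OF inf, of k] by (auto simp: G_def)
      then have "J \<le> j" using mono by (auto simp: strict_mono_less)
      then have "1 / real (Suc j) \<le> 1 / real (Suc J)" by (simp add: field_simps)
      then show ?thesis using j J by (auto simp: G_def U_def)
    qed
    then show ?thesis by blast
  qed
  then have "(\<lambda>k. y (enumerate S k)) \<longlonglongrightarrow> l"
    by (simp add: lim_sequentially)
  moreover have "strict_mono (enumerate S)"
    using inf by (simp add: strict_mono_def)
  ultimately show "l \<in> limit_points y (summable_ideal f)"
    using range not_sum Spos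
    by (auto simp: limit_points_def summable_ideal_def intro!: exI [of _ "enumerate S"])
qed

section \<open>Thinning\<close>

text \<open>Truncated subtraction makes \<open>nth_elem A 0\<close> and \<open>nth_elem A 1\<close>
  equal, so strict monotonicity holds only from index 1 on. The bound
  \<open>k \<le> nth_elem A k\<close> rests on \<open>A\<close> avoiding 0.\<close>

lemma nth_elem_props:
  assumes "infinite A" "A \<subseteq> {1..}"
  shows "strict_mono_on {1..} (nth_elem A)" "nth_elem A ` {1..} = A"
    "\<And>k. k \<le> nth_elem A k" "nth_elem A k \<in> A"
proof -
  show "strict_mono_on {1..} (nth_elem A)"
    using assms by (auto simp: strict_mono_on_def nth_elem_def)
  show mem: "nth_elem A k \<in> A" for k
    using assms by (simp add: nth_elem_def enumerate_in_set)
  have "a \<in> nth_elem A ` {1..}" if a: "a \<in> A" for a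
  proof -
    obtain k where "enumerate A k = a" using enumerate_Ex [OF assms(1) a] by auto
    then show ?thesis by (auto simp: nth_elem_def intro!: image_eqI [of _ _ "Suc k"])
  qed
  then show "nth_elem A ` {1..} = A" using mem by auto
  show "k \<le> nth_elem A k" for k
  proof (cases k)
    case (Suc m)
    have "enumerate A m \<ge> Suc m"
    proof (induction m)
      case 0
      then show ?case using enumerate_in_set [OF assms(1), of 0] assms(2) by auto
    next
      case (Suc m)
      then show ?case using enumerate_step [OF assms(1), of m] by simp
    qed
    then show ?thesis using Suc by (simp add: nth_elem_def)
  qed simp
qed

text \<open>The \<open>m\<close>-th element of \<open>Y\<close> is \<open>g\<close> of the
  \<open>j m\<close>-th element of \<open>K\<close>. As \<open>g\<close> is increasing, so is
  \<open>j\<close>, whence \<open>m \<le> j m\<close>; then \<open>k \<le> g k\<close> finishes the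
  comparison.\<close>

lemma set_le_image:
  assumes K: "infinite K" and Y: "infinite Y" "Y \<subseteq> g ` K"
    and g: "strict_mono_on K g" "\<And>k. k \<in> K \<Longrightarrow> k \<le> g k"
  shows "set_le K Y"
proof -
  have "\<exists>j. enumerate Y m = g (enumerate K j)" for m
    using enumerate_in_set [OF Y(1), of m] Y(2) enumerate_Ex [OF K] by blast
  then obtain j where j: "\<And>m. enumerate Y m = g (enumerate K (j m))" by metis
  have "strict_mono j"
  proof (rule strict_monoI)
    fix a b :: nat assume "a < b"
    then have "g (enumerate K (j a)) < g (enumerate K (j b))"
      using Y(1) by (simp flip: j)
    then have "enumerate K (j a) < enumerate K (j b)"
      using g(1) enumerate_in_set [OF K] by (simp add: strict_mono_on_less)
    then show "j a < j b" using K by simp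
  qed
  have "enumerate K m \<le> enumerate Y m" for m
  proof -
    have "enumerate K m \<le> enumerate K (j m)"
      using strict_mono_imp_increasing [OF \<open>strict_mono j\<close>] K by simp
    also have "\<dots> \<le> enumerate Y m"
      using g(2) enumerate_in_set [OF K] by (simp add: j)
    finally show ?thesis .
  qed
  then show ?thesis by (simp add: set_le_def nth_elem_def)
qed

text \<open>The domination clause enters here: \<open>nth_elem A\<close> maps the set of positions
  onto \<open>A \<inter> B\<close> and never decreases an index, so \<open>set_le_image\<close>
  applies.\<close>

lemma thinnable_preimage_notin:
  assumes thin: "thinnable \<I>" and A: "A \<subseteq> {1..}" and inf: "infinite A"
    and B: "A \<inter> B \<notin> \<I>"
  shows "{k\<in>{1..}. nth_elem A k \<in> B} \<notin> \<I>" (is "?K \<notin> \<I>")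
proof -
  note nth = nth_elem_props [OF inf A]
  have AB: "infinite (A \<inter> B)"
  proof
    assume "finite (A \<inter> B)"
    moreover have "A \<inter> B \<subseteq> {1..}" using A by blast
    ultimately show False
      using thin B unfolding thinnable_def ideal_on_pos_def by metis
  qed
  have img: "A \<inter> B \<subseteq> nth_elem A ` ?K"
  proof
    fix a assume a: "a \<in> A \<inter> B"
    then obtain k where "k \<in> {1..}" "a = nth_elem A k" using nth(2) by blast
    then show "a \<in> nth_elem A ` ?K" using a by blast
  qed
  then have "infinite ?K" using AB finite_surj by blast
  moreover from this have "set_le ?K (A \<inter> B)"
    using AB img nth by (intro set_le_image [of _ _ "nth_elem A"])
      (auto simp: strict_mono_on_def)
  moreover have "?K \<subseteq> {1..}" "A \<inter> B \<subseteq> {1..}" using A by auto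
  ultimately show ?thesis
    using thin B unfolding thinnable_def by blast
qed

section \<open>Dyadic digits are independent fair bits\<close>

abbreviation unit_lebesgue :: "real measure" where
  "unit_lebesgue \<equiv> lebesgue_on {0<..1}"

interpretation unit_lebesgue: prob_space unit_lebesgue
  by (intro prob_spaceI) (simp add: emeasure_restrict_space space_restrict_space)

lemma space_unit_lebesgue [simp]: "space unit_lebesgue = {0<..1}"
  by (simp add: space_restrict_space)

lemma dyadic_digit_props:
  assumes "0 < \<omega>" "\<omega> \<le> 1"
  shows "dyadic_digit \<omega> i \<in> {0, 1}" "dyadic_digit \<omega> 0 = 0" "infinite {i. dyadic_digit \<omega> i = 1}"
  using dyadic_expansion_dyadic_digit [OF assms] unfolding dyadic_expansion_def by blast+

text \<open>The integer \<open>\<lceil>2 ^ n * \<omega>\<rceil> - 1\<close> has the first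
  \<open>n\<close> digits as its binary digits. Ceiling minus one, rather than floor, reflects the
  non-terminating choice at dyadic rationals.\<close>

lemma dyadic_digit_Suc:
  assumes "0 < \<omega>" "\<omega> \<le> 1"
  shows "int (dyadic_digit \<omega> (Suc n)) = (\<lceil>2 ^ Suc n * \<omega>\<rceil> - 1) - 2 * (\<lceil>2 ^ n * \<omega>\<rceil> - 1)"
  unfolding dyadic_expansion_ceiling [OF dyadic_expansion_dyadic_digit [OF assms]]
    sum.atMost_Suc sum_distrib_left
  by (simp add: Suc_diff_le mult.left_commute)

text \<open>On the unit interval the ceiling formula replaces the description operator
  \<open>THE\<close> by a Borel function, which stays measurable for the completed measure.\<close>

lemma measurable_dyadic_digit [measurable]:
  "(\<lambda>\<omega>. dyadic_digit \<omega> i) \<in> measurable unit_lebesgue (count_space UNIV)"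
proof (cases i)
  case 0
  have "(\<lambda>\<omega>. 0) \<in> measurable unit_lebesgue (count_space (UNIV :: nat set))" by simp
  then show ?thesis
    unfolding 0 by (rule measurable_cong [THEN iffD1, rotated]) (simp add: dyadic_digit_props)
next
  case (Suc n)
  have "(\<lambda>\<omega>::real. nat ((\<lceil>2 ^ Suc n * \<omega>\<rceil> - 1) - 2 * (\<lceil>2 ^ n * \<omega>\<rceil> - 1)))
      \<in> measurable borel (count_space UNIV)"
    by measurable
  then have "(\<lambda>\<omega>::real. nat ((\<lceil>2 ^ Suc n * \<omega>\<rceil> - 1) - 2 * (\<lceil>2 ^ n * \<omega>\<rceil> - 1)))
      \<in> measurable unit_lebesgue (count_space UNIV)"
    by (intro measurable_restrict_space1 measurable_completion) simp
  then show ?thesis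
    unfolding Suc
    by (rule measurable_cong [THEN iffD1, rotated])
      (metis nat_int dyadic_digit_Suc greaterThanAtMost_iff space_unit_lebesgue)
qed

section \<open>Joint law of the digits\<close>

text \<open>\<open>C\<close> is the integer with binary digits \<open>e 1\<close>, ...,
  \<open>e n\<close>; appending a digit sends it to \<open>2 * C + e (Suc n)\<close>.\<close>

lemma dyadic_cylinder:
  assumes e: "\<And>i. i \<in> {1..n} \<Longrightarrow> e i \<in> {0, 1}"
  obtains C :: int where "0 \<le> C" "C < 2 ^ n"
    "{\<omega>\<in>{0<..1}. \<forall>i\<in>{1..n}. dyadic_digit \<omega> i = e i} = {\<omega>\<in>{0<..1}. \<lceil>2 ^ n * \<omega>\<rceil> - 1 = C}"
  using e
proof (induction n arbitrary: thesis)
  case 0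
  have "\<lceil>\<omega>\<rceil> = 1" if "\<omega> \<in> {0<..1::real}" for \<omega>
    using that by (auto simp: ceiling_eq_iff)
  then show ?case by (intro 0(1) [of 0]) auto
next
  case (Suc n)
  obtain C where C: "0 \<le> C" "C < 2 ^ n"
    "{\<omega>\<in>{0<..1}. \<forall>i\<in>{1..n}. dyadic_digit \<omega> i = e i} = {\<omega>\<in>{0<..1}. \<lceil>2 ^ n * \<omega>\<rceil> - 1 = C}"
    by (rule Suc.IH) (use Suc.prems(2) in auto)
  have e: "e (Suc n) = 0 \<or> e (Suc n) = 1" using Suc.prems(2) [of "Suc n"] by auto
  have "(\<forall>i\<in>{1..Suc n}. dyadic_digit \<omega> i = e i) \<longleftrightarrow>
      \<lceil>2 ^ Suc n * \<omega>\<rceil> - 1 = 2 * C + int (e (Suc n))" if \<omega>: "\<omega> \<in> {0<..1}" for \<omega>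
  proof -
    have *: "int (dyadic_digit \<omega> (Suc n)) = (\<lceil>2 ^ Suc n * \<omega>\<rceil> - 1) - 2 * (\<lceil>2 ^ n * \<omega>\<rceil> - 1)"
      by (rule dyadic_digit_Suc) (use \<omega> in auto)
    have **: "dyadic_digit \<omega> (Suc n) = 0 \<or> dyadic_digit \<omega> (Suc n) = 1"
      using \<omega> dyadic_digit_props(1) [of \<omega> "Suc n"] by simp
    have "{1..Suc n} = insert (Suc n) {1..n}" by auto
    then have "(\<forall>i\<in>{1..Suc n}. dyadic_digit \<omega> i = e i) \<longleftrightarrow>
        dyadic_digit \<omega> (Suc n) = e (Suc n) \<and> \<omega> \<in> {\<omega>\<in>{0<..1}. \<forall>i\<in>{1..n}. dyadic_digit \<omega> i = e i}"
      using \<omega> by simp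
    also have "\<dots> \<longleftrightarrow> dyadic_digit \<omega> (Suc n) = e (Suc n) \<and> \<lceil>2 ^ n * \<omega>\<rceil> - 1 = C"
      unfolding C(3) using \<omega> by simp
    \<comment> \<open>For the converse, the new digit and \<open>e (Suc n)\<close> are both 0 or 1
      and differ by an even number, so they agree, and the coarser ceiling must be
      \<open>C + 1\<close>.\<close>
    also have "\<dots> \<longleftrightarrow> \<lceil>2 ^ Suc n * \<omega>\<rceil> - 1 = 2 * C + int (e (Suc n))"
      using * ** e by presburger
    finally show ?thesis .
  qed
  then show ?case
    using C e by (intro Suc.prems(1) [of "2 * C + int (e (Suc n))"]) auto
qed

text \<open>A cylinder is the half-open interval from \<open>C / 2 ^ n\<close> to
  \<open>(C + 1) / 2 ^ n\<close>; the bounds on \<open>C\<close> keep all of it inside the unit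
  interval.\<close>

lemma prob_dyadic_cylinder:
  assumes e: "\<And>i. i \<in> {1..n} \<Longrightarrow> e i \<in> {0, 1}"
  shows "measure unit_lebesgue {\<omega>\<in>{0<..1}. \<forall>i\<in>{1..n}. dyadic_digit \<omega> i = e i} = (1/2) ^ n"
proof -
  obtain C :: int where C: "0 \<le> C" "C < 2 ^ n"
    "{\<omega>\<in>{0<..1}. \<forall>i\<in>{1..n}. dyadic_digit \<omega> i = e i} = {\<omega>\<in>{0<..1}. \<lceil>2 ^ n * \<omega>\<rceil> - 1 = C}"
    by (rule dyadic_cylinder [of n e, OF e])
  have "of_int C + 1 \<le> (2::real) ^ n"
    using C(2) of_int_le_iff [of "C + 1" "2 ^ n", where 'a = real] by simp
  then have sub: "(of_int C + 1) / 2 ^ n \<le> (1::real)" "0 \<le> of_int C / (2::real) ^ n"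
    using C(1) by auto
  have iff: "\<lceil>2 ^ n * \<omega>\<rceil> - 1 = C \<longleftrightarrow> of_int C / 2 ^ n < \<omega> \<and> \<omega> \<le> (of_int C + 1) / 2 ^ n" for \<omega> :: real
  proof -
    have "\<lceil>2 ^ n * \<omega>\<rceil> - 1 = C \<longleftrightarrow> \<lceil>2 ^ n * \<omega>\<rceil> = C + 1" by auto
    then show ?thesis by (simp add: ceiling_eq_iff field_simps)
  qed
  have subset: "{of_int C / 2 ^ n<..(of_int C + 1) / 2 ^ n} \<subseteq> {0<..1::real}"
    using le_less_trans [OF sub(2)] order_trans [OF _ sub(1)]
    unfolding subset_iff greaterThanAtMost_iff by blast
  then have "{\<omega>\<in>{0<..1::real}. \<lceil>2 ^ n * \<omega>\<rceil> - 1 = C} = {of_int C / 2 ^ n<..(of_int C + 1) / 2 ^ n}"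
    unfolding iff subset_iff set_eq_iff mem_Collect_eq greaterThanAtMost_iff by blast
  moreover have "measure unit_lebesgue {of_int C / 2 ^ n<..(of_int C + 1) / 2 ^ n} = (1/2) ^ n"
    using subset
    by (simp add: measure_restrict_space divide_right_mono diff_divide_distrib [symmetric] power_one_over)
  ultimately show ?thesis using C(3) by simp
qed

text \<open>With \<open>J\<close> contained in \<open>{1..n}\<close>, the event is a disjoint union
  of cylinders of probability \<open>(1/2) ^ n\<close> each, so only digit patterns have to be
  counted.\<close>

lemma prob_dyadic_digits:
  assumes J: "finite J" "J \<subseteq> {1..}"
  shows "measure unit_lebesgue {\<omega>\<in>{0<..1}. \<forall>j\<in>J. dyadic_digit \<omega> j \<in> S j} =
    (\<Prod>j\<in>J. card (S j \<inter> {0, 1}) / 2)"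
proof -
  obtain n where n: "J \<subseteq> {1..n}"
    using J by (metis Int_iff atLeastAtMost_iff atLeast_iff finite_nat_iff_bounded_le atMost_iff subset_iff)
  define T where "T i = (if i \<in> J then S i else UNIV) \<inter> {0, 1::nat}" for i
  define D where "D e = {\<omega>\<in>{0<..1}. \<forall>i\<in>{1..n}. dyadic_digit \<omega> i = e i}" for e
  have "{\<omega>\<in>{0<..1}. \<forall>j\<in>J. dyadic_digit \<omega> j \<in> S j} = (\<Union>e\<in>PiE {1..n} T. D e)"
  proof (intro equalityI subsetI)
    fix \<omega> assume \<omega>: "\<omega> \<in> {\<omega>\<in>{0<..1}. \<forall>j\<in>J. dyadic_digit \<omega> j \<in> S j}"
    then have "restrict (dyadic_digit \<omega>) {1..n} \<in> PiE {1..n} T"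
      using dyadic_digit_props(1) [of \<omega>] by (auto simp: T_def)
    moreover have "\<omega> \<in> D (restrict (dyadic_digit \<omega>) {1..n})"
      using \<omega> by (auto simp: D_def)
    ultimately show "\<omega> \<in> (\<Union>e\<in>PiE {1..n} T. D e)" by blast
  next
    fix \<omega> assume "\<omega> \<in> (\<Union>e\<in>PiE {1..n} T. D e)"
    then obtain e where e: "e \<in> PiE {1..n} T" "\<omega> \<in> D e" by blast
    have "dyadic_digit \<omega> j \<in> S j" if "j \<in> J" for j
    proof -
      have "j \<in> {1..n}" using that n by auto
      then have "e j \<in> T j" "dyadic_digit \<omega> j = e j" using e by (auto simp: D_def)
      then show ?thesis using that by (auto simp: T_def)
    qed
    then show "\<omega> \<in> {\<omega>\<in>{0<..1}. \<forall>j\<in>J. dyadic_digit \<omega> j \<in> S j}"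
      using e by (auto simp: D_def)
  qed
  also have "measure unit_lebesgue (\<Union>e\<in>PiE {1..n} T. D e) =
      (\<Sum>e\<in>PiE {1..n} T. measure unit_lebesgue (D e))"
  proof (rule unit_lebesgue.finite_measure_finite_Union)
    show "finite (PiE {1..n} T)" by (intro finite_PiE) (auto simp: T_def)
    have "{\<omega> \<in> space unit_lebesgue. \<forall>i\<in>{1..n}. dyadic_digit \<omega> i = e i} \<in> sets unit_lebesgue" for e
      by measurable
    then show "D ` PiE {1..n} T \<subseteq> sets unit_lebesgue" by (auto simp: D_def)
    show "disjoint_family_on D (PiE {1..n} T)"
    proof (unfold disjoint_family_on_def, intro ballI impI)
      fix e e' assume e: "e \<in> PiE {1..n} T" "e' \<in> PiE {1..n} T" "e \<noteq> e'"
      then obtain i where "i \<in> {1..n}" "e i \<noteq> e' i" by (metis PiE_ext)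
      then show "D e \<inter> D e' = {}" by (fastforce simp: D_def)
    qed
  qed
  also have "\<dots> = (\<Sum>e\<in>PiE {1..n} T. (1/2) ^ n)"
    unfolding D_def by (intro sum.cong refl prob_dyadic_cylinder) (auto simp: T_def)
  also have "\<dots> = (\<Prod>i\<in>{1..n}. real (card (T i)) / 2)"
    by (simp add: card_PiE prod_dividef power_one_over)
  \<comment> \<open>Indices outside \<open>J\<close> leave both digits free and contribute the
    factor \<open>2 / 2 = 1\<close>.\<close>
  also have "\<dots> = (\<Prod>i\<in>J. real (card (T i)) / 2)"
    using n by (intro prod.mono_neutral_right) (auto simp: T_def)
  also have "\<dots> = (\<Prod>j\<in>J. card (S j \<inter> {0, 1}) / 2)"
    by (intro prod.cong) (auto simp: T_def)
  finally show ?thesis .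
qed

lemma indep_dyadic_digits:
  "unit_lebesgue.indep_vars (\<lambda>_. count_space UNIV) (\<lambda>i \<omega>. dyadic_digit \<omega> i) {1..}"
  unfolding unit_lebesgue.indep_vars_def2
proof (intro conjI ballI unit_lebesgue.indep_setsI)
  fix A and J :: "nat set"
  assume J: "J \<noteq> {}" "J \<subseteq> {1..}" "finite J"
    and A: "\<forall>j\<in>J. A j \<in> {(\<lambda>\<omega>. dyadic_digit \<omega> j) -` B \<inter> space unit_lebesgue |B.
      B \<in> sets (count_space UNIV)}"
  have "\<forall>j\<in>J. \<exists>B. A j = {\<omega>\<in>{0<..1}. dyadic_digit \<omega> j \<in> B}"
  proof
    fix j assume "j \<in> J"
    then obtain B where "A j = (\<lambda>\<omega>. dyadic_digit \<omega> j) -` B \<inter> space unit_lebesgue"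
      using A by blast
    then have "A j = {\<omega>\<in>{0<..1}. dyadic_digit \<omega> j \<in> B}" by auto
    then show "\<exists>B. A j = {\<omega>\<in>{0<..1}. dyadic_digit \<omega> j \<in> B}" ..
  qed
  then obtain B where B: "\<And>j. j \<in> J \<Longrightarrow> A j = {\<omega>\<in>{0<..1}. dyadic_digit \<omega> j \<in> B j}" by metis
  have eq: "(\<Inter>j\<in>J. A j) = {\<omega>\<in>{0<..1}. \<forall>j\<in>J. dyadic_digit \<omega> j \<in> B j}"
    using B J by auto
  have prob: "measure unit_lebesgue (A j) = card (B j \<inter> {0, 1}) / 2" if "j \<in> J" for j
  proof -
    have "measure unit_lebesgue {\<omega>\<in>{0<..1}. \<forall>k\<in>{j}. dyadic_digit \<omega> k \<in> B k} =
        (\<Prod>k\<in>{j}. card (B k \<inter> {0, 1}) / 2)"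
      by (rule prob_dyadic_digits) (use J that in auto)
    then show ?thesis using B [OF that] by simp
  qed
  have "measure unit_lebesgue (\<Inter>j\<in>J. A j) = (\<Prod>j\<in>J. card (B j \<inter> {0, 1}) / 2)"
    unfolding eq using J by (intro prob_dyadic_digits)
  also have "\<dots> = (\<Prod>j\<in>J. measure unit_lebesgue (A j))"
    by (intro prod.cong refl prob [symmetric])
  finally show "measure unit_lebesgue (\<Inter>j\<in>J. A j) = (\<Prod>j\<in>J. measure unit_lebesgue (A j))" .
next
  show "{(\<lambda>\<omega>. dyadic_digit \<omega> i) -` B \<inter> space unit_lebesgue |B. B \<in> sets (count_space UNIV)}
      \<subseteq> sets unit_lebesgue" for i
    using measurable_sets [OF measurable_dyadic_digit] by blast
qed simp

text \<open>A general \<open>\<phi>\<close> serves both the mean of a digit and, later, the Laplace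
  transform.\<close>

lemma nn_integral_dyadic_digit:
  fixes \<phi> :: "nat \<Rightarrow> ennreal"
  assumes "i \<ge> 1"
  shows "(\<integral>\<^sup>+\<omega>. \<phi> (dyadic_digit \<omega> i) \<partial>unit_lebesgue) = (\<phi> 0 + \<phi> 1) / 2"
proof -
  let ?D = "\<lambda>b. {\<omega>\<in>space unit_lebesgue. dyadic_digit \<omega> i = b}"
  have D [measurable]: "?D b \<in> sets unit_lebesgue" for b by measurable
  have prob: "emeasure unit_lebesgue (?D b) = 1 / 2" if "b \<in> {0, 1}" for b
  proof -
    have "measure unit_lebesgue (?D b) = 1 / 2"
    proof -
      have "measure unit_lebesgue {\<omega>\<in>{0<..1}. \<forall>k\<in>{i}. dyadic_digit \<omega> k \<in> {b}} =
          (\<Prod>k\<in>{i}. card ({b} \<inter> {0, 1}) / 2)"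
        by (rule prob_dyadic_digits) (use assms in auto)
      moreover have "{b} \<inter> {0, 1} = {b}" using that by auto
      ultimately show ?thesis by simp
    qed
    then have "emeasure unit_lebesgue (?D b) = ennreal (1 / 2)"
      by (simp only: unit_lebesgue.emeasure_eq_measure)
    also have "\<dots> = 1 / 2"
      using divide_ennreal [of 1 2] by simp
    finally show ?thesis .
  qed
  have "(\<integral>\<^sup>+\<omega>. \<phi> (dyadic_digit \<omega> i) \<partial>unit_lebesgue) =
      (\<integral>\<^sup>+\<omega>. \<phi> 0 * indicator (?D 0) \<omega> + \<phi> 1 * indicator (?D 1) \<omega> \<partial>unit_lebesgue)"
  proof (rule nn_integral_cong)
    fix \<omega> assume "\<omega> \<in> space unit_lebesgue"
    moreover from this have "dyadic_digit \<omega> i = 0 \<or> dyadic_digit \<omega> i = 1"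
      using dyadic_digit_props(1) [of \<omega> i] by simp
    ultimately show "\<phi> (dyadic_digit \<omega> i) =
        \<phi> 0 * indicator (?D 0) \<omega> + \<phi> 1 * indicator (?D 1) \<omega>"
      by auto
  qed
  also have "\<dots> = \<phi> 0 * emeasure unit_lebesgue (?D 0) + \<phi> 1 * emeasure unit_lebesgue (?D 1)"
    by (subst nn_integral_add, measurable, measurable) (simp only: nn_integral_cmult_indicator D)
  also have "\<dots> = \<phi> 0 * (1 / 2) + \<phi> 1 * (1 / 2)"
    by (simp only: prob insert_iff simp_thms)
  finally show ?thesis
    by (simp add: add_divide_distrib_ennreal ennreal_times_divide)
qed

section \<open>Borel's normal number theorem and random subseries\<close>

lemma expectation_dyadic_digit:
  assumes "i \<ge> 1"
  shows "unit_lebesgue.expectation (\<lambda>\<omega>. real (dyadic_digit \<omega> i)) = 1 / 2"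
proof -
  have "unit_lebesgue.expectation (\<lambda>\<omega>. real (dyadic_digit \<omega> i)) =
      enn2real (\<integral>\<^sup>+\<omega>. ennreal (real (dyadic_digit \<omega> i)) \<partial>unit_lebesgue)"
    by (intro integral_eq_nn_integral) auto
  also have "\<dots> = enn2real ((ennreal (real 0) + ennreal (real 1)) / 2)"
    using nn_integral_dyadic_digit [OF assms, of "\<lambda>b. ennreal (real b)"] by simp
  also have "(ennreal (real 0) + ennreal (real 1)) / 2 = ennreal (1 / 2)"
    using divide_ennreal [of 1 2] by simp
  finally show ?thesis by (subst (asm) enn2real_ennreal) simp_all
qed

section \<open>Strong law for the digits\<close>

text \<open>Hoeffding's inequality for independent variables in \<open>{0..1}\<close>; the bound is
  geometric in \<open>n\<close>, hence summable as Borel-Cantelli requires.\<close>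

lemma prob_digit_sum_deviation:
  fixes \<epsilon> :: real
  assumes "\<epsilon> > 0"
  shows "measure unit_lebesgue
      {\<omega>\<in>space unit_lebesgue. \<bar>(\<Sum>i\<in>{1..n}. real (dyadic_digit \<omega> i)) - n / 2\<bar> \<ge> \<epsilon> * n}
    \<le> 2 * exp (- 2 * \<epsilon>\<^sup>2) ^ n"
\<comment> \<open>Hoeffding's exponent divides by \<open>n\<close>. At \<open>n = 0\<close> the
  claimed bound is 2, which exceeds every probability.\<close>
proof (cases "n = 0")
  case True
  have "measure unit_lebesgue A \<le> 2" for A
    using unit_lebesgue.prob_le_1 [of A] by linarith
  then show ?thesis unfolding True by simp
next
  case False
  interpret Hoeffding_ineq unit_lebesgue "{1..n}" "\<lambda>i \<omega>. real (dyadic_digit \<omega> i)"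
    "\<lambda>_. 0" "\<lambda>_. 1" "real n / 2"
  proof unfold_locales
    show "unit_lebesgue.indep_vars (\<lambda>_. borel) (\<lambda>i \<omega>. real (dyadic_digit \<omega> i)) {1..n}"
      by (rule unit_lebesgue.indep_vars_compose2
            [OF unit_lebesgue.indep_vars_subset [OF indep_dyadic_digits]]) auto
    show "AE \<omega> in unit_lebesgue. real (dyadic_digit \<omega> i) \<in> {0..1}" for i
      using dyadic_digit_props(1) [of _ i] by (intro AE_I2) force
    have "(\<Sum>i=1..n. unit_lebesgue.expectation (\<lambda>\<omega>. real (dyadic_digit \<omega> i))) = (\<Sum>i=1..n. 1 / 2)"
      by (intro sum.cong refl expectation_dyadic_digit) auto
    then show "real n / 2 \<equiv> \<Sum>i=1..n. unit_lebesgue.expectation (\<lambda>\<omega>. real (dyadic_digit \<omega> i))"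
      by (intro eq_reflection) simp
  qed simp
  have "exp (- 2 * (\<epsilon> * n)\<^sup>2 / n) = exp (- 2 * \<epsilon>\<^sup>2) ^ n"
    using False by (simp add: power2_eq_square field_simps flip: exp_of_nat_mult)
  then show ?thesis
    using Hoeffding_ineq_abs_ge [of "\<epsilon> * n"] assms False by simp
qed

text \<open>Borel-Cantelli gives eventual closeness for each fixed \<open>\<epsilon>\<close>; the
  values \<open>1 / Suc k\<close> suffice, so only countably many null sets are discarded.\<close>

lemma AE_has_density_dyadic_digits:
  "AE \<omega> in unit_lebesgue. has_density {i. i \<ge> 1 \<and> dyadic_digit \<omega> i \<noteq> 0} (1/2)"
proof -
  define Z where "Z n \<omega> = (\<Sum>i\<in>{1..n}. real (dyadic_digit \<omega> i))" for n \<omega>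
  have ev: "AE \<omega> in unit_lebesgue. \<forall>\<^sub>F n in sequentially. \<bar>Z n \<omega> - n / 2\<bar> < \<epsilon> * n" if "\<epsilon> > 0" for \<epsilon> :: real
  proof -
    let ?A = "\<lambda>n. {\<omega>\<in>space unit_lebesgue. \<bar>Z n \<omega> - n / 2\<bar> \<ge> \<epsilon> * n}"
    have "AE \<omega> in unit_lebesgue. \<forall>\<^sub>F n in sequentially. \<omega> \<in> space unit_lebesgue - ?A n"
    proof (rule borel_cantelli_AE1)
      show "?A n \<in> sets unit_lebesgue" for n unfolding Z_def by measurable
      show "emeasure unit_lebesgue (?A n) < \<infinity>" for n
        by (simp add: unit_lebesgue.emeasure_eq_measure)
      have "summable (\<lambda>n. 2 * exp (- 2 * \<epsilon>\<^sup>2) ^ n)"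
        using that by (intro summable_mult summable_geometric) simp
      then show "summable (\<lambda>n. measure unit_lebesgue (?A n))"
        by (rule summable_comparison_test' [where N = 0])
          (use prob_digit_sum_deviation [OF that] in \<open>simp add: Z_def\<close>)
    qed
    then show ?thesis
      by (rule AE_mp) (auto intro!: AE_I2 elim: eventually_mono)
  qed
  have "AE \<omega> in unit_lebesgue. \<forall>k. \<forall>\<^sub>F n in sequentially. \<bar>Z n \<omega> - n / 2\<bar> < (1 / Suc k) * n"
    unfolding AE_all_countable by (intro allI ev) simp
  then show ?thesis
  proof (rule AE_mp, intro AE_I2 impI)
    fix \<omega> assume \<omega>: "\<omega> \<in> space unit_lebesgue"
      and k: "\<forall>k. \<forall>\<^sub>F n in sequentially. \<bar>Z n \<omega> - n / 2\<bar> < (1 / Suc k) * n"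
    have digit: "dyadic_digit \<omega> i = 1" if "dyadic_digit \<omega> i > 0" for i
      using \<omega> dyadic_digit_props(1) [of \<omega> i] that by auto
    have card: "real (card ({i. i \<ge> 1 \<and> dyadic_digit \<omega> i \<noteq> 0} \<inter> {1..n})) = Z n \<omega>" for n
    proof -
      have "Z n \<omega> = (\<Sum>i\<in>{i. i \<ge> 1 \<and> dyadic_digit \<omega> i \<noteq> 0} \<inter> {1..n}. 1)"
        unfolding Z_def by (intro sum.mono_neutral_cong_right) (auto dest: digit)
      then show ?thesis by simp
    qed
    have "\<forall>\<^sub>F n in sequentially. dist (Z n \<omega> / n) (1 / 2) < e" if e: "e > 0" for e
    proof -
      obtain j where j: "1 / real (Suc j) < e" using nat_approx_posE [OF e] by auto
      have "\<forall>\<^sub>F n in sequentially. \<bar>Z n \<omega> - n / 2\<bar> < (1 / Suc j) * n" using k ..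
      then show ?thesis
        using eventually_gt_at_top [of 0]
      proof eventually_elim
        case (elim n)
        have "Z n \<omega> / n - 1 / 2 = (Z n \<omega> - n / 2) / n"
          using elim(2) by (simp add: diff_divide_distrib)
        then have "\<bar>Z n \<omega> / n - 1 / 2\<bar> = \<bar>Z n \<omega> - n / 2\<bar> / n"
          by (simp add: abs_divide)
        also have "\<dots> < 1 / Suc j" using elim by (simp add: divide_less_eq)
        finally show ?case using j by (simp add: dist_real_def)
      qed
    qed
    then show "has_density {i. i \<ge> 1 \<and> dyadic_digit \<omega> i \<noteq> 0} (1/2)"
      unfolding has_density_def card by (rule tendstoI)
  qed
qed

section \<open>Divergence of random subseries\<close>

text \<open>The new terms are at least \<open>min (f n) 1 / 4\<close>. If they were summable, only
  finitely many \<open>f n\<close> could exceed 1, and the others would be summable too. This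
  supplies the divergent exponents in the Laplace transform bound.\<close>

lemma not_summable_on_one_minus_exp:
  fixes f :: "'a \<Rightarrow> real"
  assumes nonneg: "\<And>n. n \<in> S \<Longrightarrow> f n \<ge> 0" and S: "\<not> f summable_on S"
  shows "\<not> (\<lambda>n. (1 - exp (- f n)) / 2) summable_on S"
proof
  define h where "h n = (1 - exp (- f n)) / 2" for n
  assume "(\<lambda>n. (1 - exp (- f n)) / 2) summable_on S"
  then have "h summable_on S" by (simp add: h_def [abs_def])
  moreover have "h n \<ge> 0" if "n \<in> S" for n using nonneg [OF that] by (simp add: h_def)
  ultimately obtain C where C: "\<And>F. finite F \<Longrightarrow> F \<subseteq> S \<Longrightarrow> sum h F \<le> C"
    using summable_on_nonneg_iff [of S h] by blast
  have h: "h n \<ge> min (f n) 1 / 4" if "n \<in> S" for n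
  proof -
    have f: "f n \<ge> 0" using nonneg that by simp
    have "exp (- f n) \<le> 1 / (1 + f n)"
      using exp_ge_add_one_self [of "f n"] f by (simp add: exp_minus field_simps)
    moreover have "1 / (1 + f n) \<le> 1 - min (f n) 1 / 2"
    proof (cases "f n \<le> 1")
      case True
      then have "f n * f n \<le> f n" using f by (simp add: mult_left_le)
      then have "1 \<le> (1 - f n / 2) * (1 + f n)" by (simp add: algebra_simps)
      then show ?thesis using True f by (simp add: divide_le_eq)
    qed (simp add: field_simps)
    ultimately show ?thesis by (simp add: h_def)
  qed
  have fin: "finite {n\<in>S. f n > 1}"
  proof (rule ccontr)
    assume "infinite {n\<in>S. f n > 1}"
    moreover obtain m :: nat where m: "4 * C < m" using reals_Archimedean2 by blast
    ultimately obtain F where F: "finite F" "card F = m" "F \<subseteq> {n\<in>S. f n > 1}"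
      using infinite_arbitrarily_large by blast
    have "m * (1 / 4) = (\<Sum>n\<in>F. 1 / 4)" using F by simp
    also have "\<dots> \<le> sum h F"
    proof (rule sum_mono)
      fix n assume "n \<in> F"
      then show "1 / 4 \<le> h n" using F h [of n] by auto
    qed
    also have "\<dots> \<le> C" using F by (intro C) auto
    finally show False using m by simp
  qed
  have "f summable_on {n\<in>S. f n \<le> 1}"
  proof (subst summable_on_nonneg_iff)
    have "sum f F \<le> 4 * C" if F: "finite F" "F \<subseteq> {n\<in>S. f n \<le> 1}" for F
    proof -
      have "sum f F \<le> (\<Sum>n\<in>F. 4 * h n)"
      proof (rule sum_mono)
        fix n assume "n \<in> F"
        then show "f n \<le> 4 * h n" using F h [of n] by auto
      qed
      also have "\<dots> = 4 * sum h F" by (simp add: sum_distrib_left)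
      also have "sum h F \<le> C" using F by (intro C) auto
      finally show ?thesis by simp
    qed
    then show "\<exists>C. \<forall>F. finite F \<and> F \<subseteq> {n\<in>S. f n \<le> 1} \<longrightarrow> sum f F \<le> C" by blast
  qed (use nonneg in auto)
  moreover have "f summable_on {n\<in>S. f n > 1}"
    using fin by (rule summable_on_finite)
  ultimately have "f summable_on ({n\<in>S. f n \<le> 1} \<union> {n\<in>S. f n > 1})"
    by (rule summable_on_Un_disjoint) auto
  moreover have "{n\<in>S. f n \<le> 1} \<union> {n\<in>S. f n > 1} = S" by auto
  ultimately show False using S by simp
qed

text \<open>
  With independent fair digits \<open>d\<^sub>i\<close>, the Laplace transform of the random partial sums is
  \<open>\<Prod>(1 + exp (- f i)) / 2\<close>, which tends to 0; hence the random series diverges almost surely.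
\<close>

lemma AE_not_summable_on_dyadic_digits:
  fixes f :: "nat \<Rightarrow> real"
  assumes nonneg: "\<And>n. n \<ge> 1 \<Longrightarrow> f n \<ge> 0" and B: "B \<subseteq> {1..}" and div: "\<not> f summable_on B"
  shows "AE \<omega> in unit_lebesgue. \<not> f summable_on ({i. i \<ge> 1 \<and> dyadic_digit \<omega> i \<noteq> 0} \<inter> B)"
proof -
  define h where "h n = (1 - exp (- f n)) / 2" for n
  define Bn where "Bn n = B \<inter> {0<..n}" for n
  have Bn: "finite (Bn n)" "Bn n \<subseteq> {1..}" "Bn n \<subseteq> B" for n using B by (auto simp: Bn_def)
  define L where "L n \<omega> = (\<Prod>i\<in>Bn n. ennreal (exp (- f i * dyadic_digit \<omega> i)))" for n \<omega>
  have L_meas [measurable]: "L n \<in> borel_measurable unit_lebesgue" for n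
    unfolding L_def by measurable
  \<comment> \<open>An infimum instead of a limit: it is measurable with no convergence argument,
    and its integral is below that of every \<open>L n\<close>.\<close>
  define W where "W \<omega> = (INF n. L n \<omega>)" for \<omega>
  have W_meas [measurable]: "W \<in> borel_measurable unit_lebesgue"
    unfolding W_def by measurable
  have int_L: "(\<integral>\<^sup>+\<omega>. L n \<omega> \<partial>unit_lebesgue) \<le> ennreal (exp (- sum h (Bn n)))" for n
  proof -
    have "(\<integral>\<^sup>+\<omega>. L n \<omega> \<partial>unit_lebesgue) =
        (\<Prod>i\<in>Bn n. \<integral>\<^sup>+\<omega>. ennreal (exp (- f i * dyadic_digit \<omega> i)) \<partial>unit_lebesgue)"
      unfolding L_def
      by (intro unit_lebesgue.indep_vars_nn_integral Bn unit_lebesgue.indep_vars_compose2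
            [OF unit_lebesgue.indep_vars_subset [OF indep_dyadic_digits Bn(2)]]) auto
    \<comment> \<open>Each factor equals \<open>(1 + exp (- f i)) / 2 = 1 - h i\<close>, which is at
      most \<open>exp (- h i)\<close>.\<close>
    also have "\<dots> \<le> (\<Prod>i\<in>Bn n. ennreal (exp (- h i)))"
    proof (rule prod_mono_ennreal)
      fix i assume "i \<in> Bn n"
      then have i: "i \<ge> 1" using Bn(2) by auto
      have "(\<integral>\<^sup>+\<omega>. ennreal (exp (- f i * dyadic_digit \<omega> i)) \<partial>unit_lebesgue) =
          (ennreal 1 + ennreal (exp (- f i))) / 2"
        using nn_integral_dyadic_digit [OF i, of "\<lambda>b. ennreal (exp (- f i * real b))"] by simp
      also have "\<dots> = ennreal ((1 + exp (- f i)) / 2)"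
        using divide_ennreal [of "1 + exp (- f i)" 2] by (simp add: add_nonneg_nonneg)
      also have "\<dots> \<le> ennreal (exp (- h i))"
        using exp_ge_add_one_self [of "- h i"] by (intro ennreal_leI) (simp add: h_def field_simps)
      finally show "(\<integral>\<^sup>+\<omega>. ennreal (exp (- f i * dyadic_digit \<omega> i)) \<partial>unit_lebesgue)
          \<le> ennreal (exp (- h i))" .
    qed
    also have "\<dots> = ennreal (exp (- sum h (Bn n)))"
      using Bn(1) by (simp add: prod_ennreal exp_sum sum_negf [symmetric])
    finally show ?thesis .
  qed
  have "(\<integral>\<^sup>+\<omega>. W \<omega> \<partial>unit_lebesgue) = 0"
  proof (rule ccontr)
    assume "(\<integral>\<^sup>+\<omega>. W \<omega> \<partial>unit_lebesgue) \<noteq> 0"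
    moreover have W_le: "(\<integral>\<^sup>+\<omega>. W \<omega> \<partial>unit_lebesgue) \<le> ennreal (exp (- sum h (Bn n)))" for n
      by (rule order_trans [OF nn_integral_mono int_L]) (auto simp: W_def intro: INF_lower)
    moreover from W_le [of 0] have "(\<integral>\<^sup>+\<omega>. W \<omega> \<partial>unit_lebesgue) \<noteq> top"
      by (auto simp: top_unique)
    ultimately obtain r where r: "r > 0" "(\<integral>\<^sup>+\<omega>. W \<omega> \<partial>unit_lebesgue) = ennreal r"
      by (metis ennreal_cases ennreal_0 less_eq_real_def)
    have "\<not> h summable_on B"
      unfolding h_def [abs_def] by (rule not_summable_on_one_minus_exp [OF _ div]) (use nonneg B in auto)
    \<comment> \<open>This threshold gives \<open>exp (- sum h (Bn m)) \<le> r / exp 1 < r\<close>,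
      contradicting \<open>W_le\<close>.\<close>
    then obtain m where "sum h (Bn m) \<ge> 1 - ln r"
      unfolding Bn_def using nonneg B by (elim not_summable_on_sum_ge [rotated]) (auto simp: h_def)
    then have "exp (- sum h (Bn m)) < exp (ln r)" by simp
    moreover have "r \<le> exp (- sum h (Bn m))" using W_le [of m] r by simp
    ultimately show False using r(1) by simp
  qed
  then have "AE \<omega> in unit_lebesgue. W \<omega> = 0"
    by (subst (asm) nn_integral_0_iff_AE) auto
  then show ?thesis
  proof (rule AE_mp, intro AE_I2 impI notI)
    fix \<omega> assume \<omega>: "\<omega> \<in> space unit_lebesgue" and W: "W \<omega> = 0"
      and sum: "f summable_on ({i. i \<ge> 1 \<and> dyadic_digit \<omega> i \<noteq> 0} \<inter> B)" (is "f summable_on ?S")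
    have digit: "dyadic_digit \<omega> i = 1" if "dyadic_digit \<omega> i > 0" for i
      using \<omega> dyadic_digit_props(1) [of \<omega> i] that by auto
    \<comment> \<open>A convergent subseries would bound all exponents by its sum and so keep every
      \<open>L n \<omega>\<close> above one positive constant.\<close>
    have "ennreal (exp (- infsum f ?S)) \<le> L n \<omega>" for n
    proof -
      have "(\<Sum>i\<in>Bn n. f i * dyadic_digit \<omega> i) = sum f (Bn n \<inter> ?S)"
        using Bn by (intro sum.mono_neutral_cong_right) (auto simp: subset_iff dest: digit)
      also have "\<dots> \<le> infsum f ?S"
        using Bn nonneg by (intro finite_sum_le_infsum [OF sum]) auto
      finally have "exp (- infsum f ?S) \<le> exp (\<Sum>i\<in>Bn n. - f i * dyadic_digit \<omega> i)"
        by (simp add: sum_negf)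
      also have "\<dots> = (\<Prod>i\<in>Bn n. exp (- f i * dyadic_digit \<omega> i))"
        using Bn(1) by (rule exp_sum)
      finally show ?thesis
        unfolding L_def by (subst prod_ennreal) (auto intro: ennreal_leI)
    qed
    then have "ennreal (exp (- infsum f ?S)) \<le> W \<omega>"
      unfolding W_def by (intro INF_greatest) auto
    then show False using W by simp
  qed
qed

section \<open>Thinning preserves limit points almost surely\<close>

text \<open>The deterministic part, for one fixed \<open>\<omega>\<close>: \<open>dens\<close> and
  \<open>balls\<close> are the almost sure properties. Both sides become cluster-point conditions,
  which are compared ball by ball.\<close>

lemma limit_points_subseq_along:
  fixes f :: "nat \<Rightarrow> real" and x :: "nat \<Rightarrow> 'a::metric_space"
  assumes nonneg: "\<And>n. n \<ge> 1 \<Longrightarrow> f n \<ge> 0"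
    and thin: "thinnable (summable_ideal f)"
    and D: "closure D = UNIV"
    and \<omega>: "0 < \<omega>" "\<omega> \<le> 1"
  defines "A \<equiv> {i. i \<ge> 1 \<and> dyadic_digit \<omega> i \<noteq> 0}"
  assumes dens: "has_density A (1/2)"
    and balls: "\<And>q m. q \<in> D \<Longrightarrow> {n\<in>{1..}. dist (x n) q < 1 / Suc m} \<notin> summable_ideal f \<Longrightarrow>
      A \<inter> {n\<in>{1..}. dist (x n) q < 1 / Suc m} \<notin> summable_ideal f"
  shows "limit_points x (summable_ideal f) = limit_points (subseq_along x \<omega>) (summable_ideal f)"
proof -
  have A: "A \<subseteq> {1..}" by (auto simp: A_def)
  have "{i. dyadic_digit \<omega> i = 1} \<subseteq> A"
    using dyadic_digit_props(2) [OF \<omega>] by (auto simp: A_def Suc_le_eq intro: gr0I)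
  then have inf: "infinite A"
    using dyadic_digit_props(3) [OF \<omega>] infinite_super by blast
  have mono: "T \<notin> summable_ideal f" if "S \<notin> summable_ideal f" "S \<subseteq> T" for S T
    using that thin unfolding thinnable_def ideal_on_pos_def by meson
  have sub: "subseq_along x \<omega> k = x (nth_elem A k)" for k
    by (simp add: subseq_along_def A_def)
  have "(\<forall>e>0. {n\<in>{1..}. dist (x n) l < e} \<notin> summable_ideal f) \<longleftrightarrow>
      (\<forall>e>0. {k\<in>{1..}. dist (x (nth_elem A k)) l < e} \<notin> summable_ideal f)" for l
  proof (intro iffI allI impI)
    fix e :: real
    assume l: "\<forall>e>0. {n\<in>{1..}. dist (x n) l < e} \<notin> summable_ideal f" and "e > 0"
    \<comment> \<open>Half of \<open>e\<close>, because \<open>dist (x n) q\<close> and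
      \<open>dist q l\<close> will each be below \<open>1 / Suc m\<close>.\<close>
    obtain m where m: "1 / real (Suc m) < e / 2"
      using nat_approx_posE [of "e / 2"] \<open>e > 0\<close> by auto
    have "l \<in> closure D" using D by simp
    then obtain q where q: "q \<in> D" "dist q l < 1 / real (Suc m)"
      unfolding closure_approachable by (meson divide_pos_pos of_nat_0_less_iff zero_less_Suc zero_less_one)
    let ?Q = "{n\<in>{1..}. dist (x n) q < 1 / Suc m}"
    have "?Q \<notin> summable_ideal f"
    proof (rule mono)
      \<comment> \<open>The radius left after moving the centre from \<open>q\<close> to
        \<open>l\<close> is positive, so the assumption on \<open>l\<close> applies to it.\<close>
      show "{n\<in>{1..}. dist (x n) l < 1 / Suc m - dist q l} \<notin> summable_ideal f"
        using l q by auto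
      have "dist (x n) q \<le> dist (x n) l + dist q l" for n by (metis dist_commute dist_triangle)
      then show "{n\<in>{1..}. dist (x n) l < 1 / Suc m - dist q l} \<subseteq> ?Q"
        by (smt (verit) Collect_mono)
    qed
    then have "A \<inter> ?Q \<notin> summable_ideal f" using q by (intro balls)
    then have "{k\<in>{1..}. nth_elem A k \<in> ?Q} \<notin> summable_ideal f"
      by (rule thinnable_preimage_notin [OF thin A inf])
    moreover have "dist (x n) l < e" if "n \<in> ?Q" for n
      using that q m dist_triangle [of "x n" l q] by auto
    ultimately show "{k\<in>{1..}. dist (x (nth_elem A k)) l < e} \<notin> summable_ideal f"
      by (elim mono) blast
  next
    fix e :: real
    assume l: "\<forall>e>0. {k\<in>{1..}. dist (x (nth_elem A k)) l < e} \<notin> summable_ideal f"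
      and "e > 0"
    let ?K = "{k\<in>{1..}. dist (x (nth_elem A k)) l < e}"
    have "?K \<notin> summable_ideal f" using l \<open>e > 0\<close> by simp
    moreover have "\<exists>\<delta>. \<delta> \<noteq> 0 \<and> has_density A \<delta>" using dens by (intro exI [of _ "1/2"]) simp
    moreover have "?K \<subseteq> {1..}" by auto
    ultimately have "thin_by A ?K \<notin> summable_ideal f"
      using thin A unfolding thinnable_def by blast
    moreover have "thin_by A ?K \<subseteq> {n\<in>{1..}. dist (x n) l < e}"
      using nth_elem_props(4) [OF inf A] A by (auto simp: thin_by_def)
    ultimately show "{n\<in>{1..}. dist (x n) l < e} \<notin> summable_ideal f" by (rule mono)
  qed
  moreover have "limit_points y (summable_ideal f) =
      {l. \<forall>e>0. {n\<in>{1..}. dist (y n) l < e} \<notin> summable_ideal f}" for y :: "nat \<Rightarrow> 'a"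
    by (rule limit_points_summable_ideal) (rule nonneg)
  ultimately show ?thesis
    by (simp only: sub)
qed

theorem theorem4p4:
  fixes f :: "nat \<Rightarrow> real" and x :: "nat \<Rightarrow> 'a::metric_space"
  assumes "\<And>n. n \<ge> 1 \<Longrightarrow> f n \<ge> 0"
    and "\<not> f summable_on {1..}"
    and "thinnable (summable_ideal f)"
    and "separable_space (euclidean :: 'a topology)"
  shows "let E = {\<omega> \<in> {0<..1::real}.
             limit_points x (summable_ideal f) =
             limit_points (subseq_along x \<omega>) (summable_ideal f)}
         in E \<in> sets (lebesgue_on {0<..1}) \<and> emeasure (lebesgue_on {0<..1}) E = 1"
proof -
  define E where "E = {\<omega> \<in> {0<..1::real}.
    limit_points x (summable_ideal f) = limit_points (subseq_along x \<omega>) (summable_ideal f)}"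
  obtain D :: "'a set" where D: "countable D" "closure D = UNIV"
    using assms(4) by (auto simp: separable_space_def)
  let ?A = "\<lambda>\<omega>. {i. i \<ge> 1 \<and> dyadic_digit \<omega> i \<noteq> 0}"
  let ?Q = "\<lambda>q m. {n\<in>{1..}. dist (x n) q < 1 / real (Suc m)}"
  have "AE \<omega> in unit_lebesgue. \<forall>q\<in>D. \<forall>m. ?Q q m \<notin> summable_ideal f \<longrightarrow>
      ?A \<omega> \<inter> ?Q q m \<notin> summable_ideal f"
  proof (unfold AE_ball_countable [OF D(1)] AE_all_countable, intro ballI allI)
    fix q m
    show "AE \<omega> in unit_lebesgue. ?Q q m \<notin> summable_ideal f \<longrightarrow>
        ?A \<omega> \<inter> ?Q q m \<notin> summable_ideal f"
    proof (cases "?Q q m \<in> summable_ideal f")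
      case False
      then have "\<not> f summable_on ?Q q m" by (auto simp: summable_ideal_def)
      then have "AE \<omega> in unit_lebesgue. \<not> f summable_on (?A \<omega> \<inter> ?Q q m)"
        by (intro AE_not_summable_on_dyadic_digits assms(1)) auto
      then show ?thesis by (rule AE_mp) (auto simp: summable_ideal_def)
    qed simp
  qed
  then have "AE \<omega> in unit_lebesgue. \<omega> \<in> E"
    using AE_has_density_dyadic_digits AE_space
  proof eventually_elim
    case (elim \<omega>)
    have "limit_points x (summable_ideal f) = limit_points (subseq_along x \<omega>) (summable_ideal f)"
      by (rule limit_points_subseq_along [OF assms(1,3) D(2)]) (use elim in auto)
    then show ?case using elim by (simp add: E_def)
  qed
  \<comment> \<open>Measurability of \<open>E\<close> is not known beforehand. Its complement sits
    inside a null set, so completeness of Lebesgue measure makes the complement null and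
    \<open>E\<close> measurable.\<close>
  then obtain N where N: "{\<omega>\<in>space unit_lebesgue. \<omega> \<notin> E} \<subseteq> N" "N \<in> null_sets unit_lebesgue"
    by (auto simp: eventually_ae_filter)
  have null_iff: "A \<in> null_sets unit_lebesgue \<longleftrightarrow> A \<subseteq> {0<..1} \<and> A \<in> null_sets lebesgue" for A
    by (rule null_sets_restrict_space) simp
  have "{0<..1} - E \<subseteq> N" using N(1) by (simp add: subset_iff)
  moreover have "N \<in> null_sets lebesgue" using N(2) unfolding null_iff ..
  ultimately have "{0<..1} - E \<in> null_sets lebesgue" by (rule null_sets_completion_subset)
  then have null: "{0<..1} - E \<in> null_sets unit_lebesgue" unfolding null_iff by blast
  have "E \<subseteq> {0<..1}" unfolding E_def by blast
  then have "space unit_lebesgue - ({0<..1} - E) = E" by (simp add: double_diff)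
  then have sets: "E \<in> sets unit_lebesgue"
    using sets.compl_sets [OF null_setsD2 [OF null]] by metis
  have "emeasure unit_lebesgue E = 1"
    by (rule unit_lebesgue.emeasure_eq_1_AE) fact+
  with sets show ?thesis unfolding Let_def E_def by (rule conjI)
qed

end
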